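(* Let $\mathcal X,\mathcal Y$ be complex separable Hilbert spaces, let $A\in\mathcal B(\mathcal X)$, $B\in\mathcal B(\mathcal Y,\mathcal X)$, and assume that the row operator $(A\ B)\in\mathcal B(\mathcal X\oplus\mathcal Y,\mathcal X)$ is right invertible. Let $C\in\mathcal B(\mathcal X,\mathcal Y)$, $D\in\mathcal B(\mathcal Y)$ and define $$M=\begin{pmatrix}A&B\\ C&D\end{pmatrix}\in\mathcal B(\mathcal X\oplus\mathcal Y).$$ With $\mathcal X_1,\mathcal X_2,\mathcal Y_2,\widetilde A_2,B_2$ as defined in the context, define $$C_2:=P_{(\mathcal R(D|_{\mathcal N(B)}))^\perp}\,C|_{\mathcal X_1\oplus\mathcal X_2}:\mathcal X_1\oplus\mathcal X_2\to(\mathcal R(D|_{\mathcal N(B)}))^\perp,$$ $$D_2:=P_{(\mathcal R(D|_{\mathcal N(B)}))^\perp}\,D|_{\mathcal Y_2}:\mathcal Y_2\to(\mathcal R(D|_{\mathcal N(B)}))^\perp.$$ Then $M$ is an isomorphism if and only if the following two statements are satisfied: (i) The restriction $D|_{\mathcal N(B)}:\mathcal N(B)\to\mathcal Y$ is left invertible. (ii) The operator $$\left.\left(C_2-D_2B_2^{-1}\widetilde A_2\right)\right|_{P_{\mathcal X}(\mathcal N((A\ B)))}:P_{\mathcal X}(\mathcal N((A\ B)))\to(\mathcal R(D|_{\mathcal N(B)}))^\perp$$ is one-to-one and surjective.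
   Context: $\mathcal B(\mathcal X,\mathcal Y)$ denotes the bounded linear operators from $\mathcal X$ to $\mathcal Y$, and $\mathcal B(\mathcal X)=\mathcal B(\mathcal X,\mathcal X)$. $\mathcal R(T)$ and $\mathcal N(T)$ denote range and kernel of $T$. An isomorphism is a linear bijection that is bounded with bounded inverse. $T\in\mathcal B(\mathcal X,\mathcal Y)$ is right (left) invertible if there is $S\in\mathcal B(\mathcal Y,\mathcal X)$ with $TS=I_{\mathcal Y}$ (resp. $ST=I_{\mathcal X}$). $P_\Omega$ is the orthogonal projection onto a closed subspace $\Omega$; $P_{\mathcal X}$ is the projection of $\mathcal X\oplus\mathcal Y$ onto the first component. For closed subspaces $\Omega_1\subset\Omega$, $\Omega\ominus\Omega_1$ is the orthogonal complement of $\Omega_1$ in $\Omega$. The row operator is $(A\ B)\binom{x}{y}=Ax+By$. Define $\mathcal X_1:=\mathcal N(A)$, $\mathcal X_2:=\mathcal N(A)^\perp\ominus\mathcal N(P_{\mathcal R(B)^\perp}A)^\perp$, $\mathcal Y_2:=\mathcal N(B)^\perp\ominus\mathcal N(P_{\mathcal R(A)^\perp}B)^\perp$. Thus $\mathcal X_1\oplus\mathcal X_2=\mathcal N(P_{\mathcal R(B)^\perp}A)$. Let $A_2:\mathcal X_2\to\overline{\mathcal R(A)}\cap\overline{\mathcal R(B)}$ and $B_2:\mathcal Y_2\to\overline{\mathcal R(A)}\cap\overline{\mathcal R(B)}$ be the restrictions of $A$ to $\mathcal X_2$ and of $B$ to $\mathcal Y_2$ (they do take values in $\overline{\mathcal R(A)}\cap\overline{\mathcal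 R(B)}$), and let $\widetilde A_2:=(0\ A_2):\mathcal X_1\oplus\mathcal X_2\to\overline{\mathcal R(A)}\cap\overline{\mathcal R(B)}$, i.e. $\widetilde A_2$ is the restriction of $A$ to $\mathcal X_1\oplus\mathcal X_2$. $B_2$ is one-to-one and $B_2^{-1}:\mathcal R(B_2)\to\mathcal Y_2$ denotes its inverse on its range. When $(A\ B)$ is right invertible one has $P_{\mathcal X}(\mathcal N((A\ B)))\subset\mathcal X_1\oplus\mathcal X_2$ and $\widetilde A_2$ maps $P_{\mathcal X}(\mathcal N((A\ B)))$ into $\mathcal R(B_2)$, so $B_2^{-1}\widetilde A_2$ is well defined on $P_{\mathcal X}(\mathcal N((A\ B)))$ with values in $\mathcal Y_2$. *)

theory Defs
  imports "HOL-Analysis.Analysis" "HOL-Library.FuncSet"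
begin

text \<open>
  Complex inner product spaces are built on top of the library class \<^class>\<open>real_inner\<close>, so that
  norm, topology and completeness are the library's. The Hermitian form \<open>cinner\<close> is linear in
  its first argument and its real part is the real inner product; hence
  \<open>norm x = sqrt (Re (cinner x x))\<close>.
\<close>

class complex_inner = real_inner +
  fixes scaleC :: "complex \<Rightarrow> 'a \<Rightarrow> 'a" (infixr \<open>*\<^sub>C\<close> 75)
    and cinner :: "'a \<Rightarrow> 'a \<Rightarrow> complex"
  assumes scaleC_add_right: "a *\<^sub>C (x + y) = a *\<^sub>C x + a *\<^sub>C y"
    and scaleC_add_left: "(a + b) *\<^sub>C x = a *\<^sub>C x + b *\<^sub>C x"
    and scaleC_scaleC: "a *\<^sub>C (b *\<^sub>C x) = (a * b) *\<^sub>C x"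
    and scaleC_one: "1 *\<^sub>C x = x"
    and scaleR_scaleC: "r *\<^sub>R x = complex_of_real r *\<^sub>C x"
    and cinner_commute: "cinner x y = cnj (cinner y x)"
    and cinner_add_left: "cinner (x + y) z = cinner x z + cinner y z"
    and cinner_scaleC_left: "cinner (a *\<^sub>C x) y = a * cinner x y"
    and inner_eq_Re_cinner: "inner x y = Re (cinner x y)"

class complex_hilbert = complex_inner + complete_space

instantiation complex :: complex_hilbert
begin

definition scaleC_complex :: "complex \<Rightarrow> complex \<Rightarrow> complex"
  where "scaleC_complex a x = a * x"

definition cinner_complex :: "complex \<Rightarrow> complex \<Rightarrow> complex"
  where "cinner_complex x y = x * cnj y"

instance
  by standard
    (simp_all add: scaleC_complex_def cinner_complex_def inner_complex_def scaleR_conv_of_real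
      algebra_simps)

end

text \<open>
  The Hilbert space direct sum of two spaces is their product type; its norm is already the
  Hilbert sum norm in the library.
\<close>

instantiation prod :: (complex_inner, complex_inner) complex_inner
begin

definition scaleC_prod :: "complex \<Rightarrow> 'a \<times> 'b \<Rightarrow> 'a \<times> 'b"
  where "scaleC_prod a z = (a *\<^sub>C fst z, a *\<^sub>C snd z)"

definition cinner_prod :: "'a \<times> 'b \<Rightarrow> 'a \<times> 'b \<Rightarrow> complex"
  where "cinner_prod z w = cinner (fst z) (fst w) + cinner (snd z) (snd w)"

instance
proof
  fix x y :: "'a \<times> 'b"
  show "cinner x y = cnj (cinner y x)"
    by (simp add: cinner_prod_def cinner_commute[of "fst x"] cinner_commute[of "snd x"])
qed (simp_all add: scaleC_prod_def cinner_prod_def scaleC_add_right scaleC_add_left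
      scaleC_scaleC scaleC_one scaleR_scaleC scaleR_prod_def cinner_add_left cinner_scaleC_left
      inner_prod_def inner_eq_Re_cinner algebra_simps)

end

instance prod :: (complex_hilbert, complex_hilbert) complex_hilbert ..

text \<open>
  Operators between closed subspaces \<open>V\<close>, \<open>W\<close> of the ambient spaces are represented by
  functions on the ambient type of which only the values on \<open>V\<close> matter; \<open>bounded_op UNIV UNIV\<close>
  describes the bounded linear operators between the whole spaces.
\<close>

definition bounded_op ::
    "'a::complex_inner set \<Rightarrow> 'b::complex_inner set \<Rightarrow> ('a \<Rightarrow> 'b) \<Rightarrow> bool" where
  "bounded_op V W T \<longleftrightarrow>
     (\<forall>x\<in>V. T x \<in> W) \<and>
     (\<forall>x\<in>V. \<forall>y\<in>V. T (x + y) = T x + T y) \<and>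
     (\<forall>c. \<forall>x\<in>V. T (c *\<^sub>C x) = c *\<^sub>C T x) \<and>
     (\<exists>K. \<forall>x\<in>V. norm (T x) \<le> K * norm x)"

definition left_invertible ::
    "'a::complex_inner set \<Rightarrow> 'b::complex_inner set \<Rightarrow> ('a \<Rightarrow> 'b) \<Rightarrow> bool" where
  "left_invertible V W T \<longleftrightarrow>
     bounded_op V W T \<and> (\<exists>S. bounded_op W V S \<and> (\<forall>x\<in>V. S (T x) = x))"

definition right_invertible ::
    "'a::complex_inner set \<Rightarrow> 'b::complex_inner set \<Rightarrow> ('a \<Rightarrow> 'b) \<Rightarrow> bool" where
  "right_invertible V W T \<longleftrightarrow>
     bounded_op V W T \<and> (\<exists>S. bounded_op W V S \<and> (\<forall>y\<in>W. T (S y) = y))"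

definition isomorphism ::
    "'a::complex_inner set \<Rightarrow> 'b::complex_inner set \<Rightarrow> ('a \<Rightarrow> 'b) \<Rightarrow> bool" where
  "isomorphism V W T \<longleftrightarrow>
     bounded_op V W T \<and> bij_betw T V W \<and> bounded_op W V (inv_into V T)"

definition null_space_of :: "('a \<Rightarrow> 'b::zero) \<Rightarrow> 'a set" where
  "null_space_of T = {x. T x = 0}"

definition ortho :: "'a::complex_inner set \<Rightarrow> 'a set" where
  "ortho S = {x. \<forall>y\<in>S. cinner x y = 0}"

definition ominus :: "'a::complex_inner set \<Rightarrow> 'a set \<Rightarrow> 'a set" where
  "ominus V V1 = V \<inter> ortho V1"

text \<open>The description determines \<open>Proj V x\<close> when \<open>V\<close> is a closed subspace of a Hilbert space.\<close>

definition Proj :: "'a::complex_inner set \<Rightarrow> 'a \<Rightarrow> 'a" where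
  "Proj V x = (THE p. p \<in> V \<and> x - p \<in> ortho V)"

text \<open>Internal sum of two (orthogonal) subspaces.\<close>

definition sum_sub :: "'a::complex_inner set \<Rightarrow> 'a set \<Rightarrow> 'a set" where
  "sum_sub V W = {v + w | v w. v \<in> V \<and> w \<in> W}"

definition row_op :: "('x \<Rightarrow> 'z::plus) \<Rightarrow> ('y \<Rightarrow> 'z) \<Rightarrow> 'x \<times> 'y \<Rightarrow> 'z" where
  "row_op A B = (\<lambda>(x, y). A x + B y)"

definition block_op ::
    "('x \<Rightarrow> 'u::plus) \<Rightarrow> ('y \<Rightarrow> 'u) \<Rightarrow> ('x \<Rightarrow> 'v::plus) \<Rightarrow> ('y \<Rightarrow> 'v) \<Rightarrow> 'x \<times> 'y \<Rightarrow> 'u \<times> 'v" where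
  "block_op A B C D = (\<lambda>(x, y). (A x + B y, C x + D y))"

definition X1 :: "('x::complex_inner \<Rightarrow> 'x) \<Rightarrow> 'x set" where
  "X1 A = null_space_of A"

definition X2 ::
    "('x::complex_inner \<Rightarrow> 'x) \<Rightarrow> ('y::complex_inner \<Rightarrow> 'x) \<Rightarrow> 'x set" where
  "X2 A B = ominus (ortho (null_space_of A)) (ortho (null_space_of (Proj (ortho (range B)) \<circ> A)))"

definition Y2 ::
    "('x::complex_inner \<Rightarrow> 'x) \<Rightarrow> ('y::complex_inner \<Rightarrow> 'x) \<Rightarrow> 'y set" where
  "Y2 A B = ominus (ortho (null_space_of B)) (ortho (null_space_of (Proj (ortho (range A)) \<circ> B)))"

text \<open>
  \<open>A2t\<close> is the operator \<open>(0 A\<^sub>2)\<close>: since \<open>A\<close> vanishes on the first summand, it is the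
  restriction of \<open>A\<close>.
\<close>

definition A2t ::
    "('x::complex_inner \<Rightarrow> 'x) \<Rightarrow> ('y::complex_inner \<Rightarrow> 'x) \<Rightarrow> 'x \<Rightarrow> 'x" where
  "A2t A B = restrict A (sum_sub (X1 A) (X2 A B))"

definition B2 ::
    "('x::complex_inner \<Rightarrow> 'x) \<Rightarrow> ('y::complex_inner \<Rightarrow> 'x) \<Rightarrow> 'y \<Rightarrow> 'x" where
  "B2 A B = restrict B (Y2 A B)"

definition B2_inv ::
    "('x::complex_inner \<Rightarrow> 'x) \<Rightarrow> ('y::complex_inner \<Rightarrow> 'x) \<Rightarrow> 'x \<Rightarrow> 'y" where
  "B2_inv A B = inv_into (Y2 A B) (B2 A B)"

definition RD_perp ::
    "('y::complex_inner \<Rightarrow> 'x::complex_inner) \<Rightarrow> ('y \<Rightarrow> 'y) \<Rightarrow> 'y set" where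
  "RD_perp B D = ortho (D ` null_space_of B)"

definition C2 ::
    "('x::complex_inner \<Rightarrow> 'x) \<Rightarrow> ('y::complex_inner \<Rightarrow> 'x) \<Rightarrow> ('x \<Rightarrow> 'y) \<Rightarrow> ('y \<Rightarrow> 'y)
      \<Rightarrow> 'x \<Rightarrow> 'y" where
  "C2 A B C D = restrict (Proj (RD_perp B D) \<circ> C) (sum_sub (X1 A) (X2 A B))"

definition D2 ::
    "('x::complex_inner \<Rightarrow> 'x) \<Rightarrow> ('y::complex_inner \<Rightarrow> 'x) \<Rightarrow> ('y \<Rightarrow> 'y) \<Rightarrow> 'y \<Rightarrow> 'y" where
  "D2 A B D = restrict (Proj (RD_perp B D) \<circ> D) (Y2 A B)"

end

theory Submission
  imports Defs
begin

text \<open>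
  If \<open>A x + B y = 0\<close>, the operator in (ii) sends \<open>x\<close> to the projection of \<open>C x + D y\<close> onto the
  orthogonal complement of \<open>D (N B)\<close>, whichever solution \<open>y\<close> is taken. Since \<open>(A B)\<close> is onto,
  bijectivity of the block operator reduces to bijectivity of \<open>(C D)\<close> on the kernel of \<open>(A B)\<close>,
  and splitting off \<open>N B\<close>, on which \<open>D\<close> is bounded below with closed range, leaves exactly (ii).
  The bounded inverse theorem turns bijectivity into isomorphism.
\<close>

instance complex_hilbert \<subseteq> banach ..

section \<open>The bounded inverse theorem\<close>

text \<open>The level sets cover the space, since every norm lies below some natural number; by
  Baire their closures cannot all have empty interior.\<close>

lemma interior_closure_level_set:
  fixes S :: "'b::{complete_space,real_normed_vector} \<Rightarrow> 'a::real_normed_vector"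
  obtains n :: nat where "interior (closure {y. norm (S y) \<le> real n}) \<noteq> {}"
proof -
  let ?E = "\<lambda>n::nat. closure {y. norm (S y) \<le> real n}"
  have "\<exists>n::nat. y \<in> ?E n" for y
  proof -
    obtain n :: nat where "norm (S y) \<le> real n" using real_arch_simple by blast
    then have "y \<in> {y. norm (S y) \<le> real n}" by simp
    then show ?thesis using closure_subset[THEN subsetD] by metis
  qed
  then have cover: "\<Union>(range ?E) = UNIV" by auto
  show thesis
  proof (rule ccontr)
    assume "\<not> thesis"
    then have empty: "interior (?E n) = {}" for n using that by blast
    have "euclidean interior_of \<Union>(range ?E) = {}"
      by (rule Baire_category_alt) (auto simp: completely_metrizable_space_euclidean empty)
    then show False unfolding cover by simp
  qed
qed

text \<open>The open mapping argument: Baire lets every \<open>y\<close> be approximated by points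
  with controlled norm under the inverse \<open>S\<close>, and iterating on the error writes
  \<open>y\<close> as a series whose image under \<open>S\<close> converges absolutely.\<close>

lemma bounded_linear_inv:
  fixes T :: "'a::banach \<Rightarrow> 'b::banach"
  assumes T: "bounded_linear T" and "bij T"
  shows "bounded_linear (inv T)"
proof -
  interpret T: bounded_linear T by fact
  define S where "S = inv T"
  have TS: "T (S y) = y" and ST: "S (T x) = x" for x y
    using \<open>bij T\<close> unfolding S_def by (simp_all add: bij_is_surj surj_f_inv_f bij_is_inj)
  have Sadd: "S (a + b) = S a + S b" for a b
    by (metis TS ST T.add)
  have Sscale: "S (c *\<^sub>R a) = c *\<^sub>R S a" for a c
    by (metis TS ST T.scaleR)
  have Sdiff: "S (a - b) = S a - S b" for a b
    by (metis TS ST T.diff)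
  obtain n :: nat where "interior (closure {y. norm (S y) \<le> real n}) \<noteq> {}"
    using interior_closure_level_set by blast
  then obtain y0 r where r: "r > 0" "ball y0 r \<subseteq> closure {y. norm (S y) \<le> real n}"
    by (meson all_not_in_conv mem_interior)
  \<comment> \<open>Both \<open>y0\<close> and \<open>y0 + y\<close> are limits of the level set;
    the difference of two approximants approximates \<open>y\<close>, at the cost of doubling the
    bound \<open>n\<close>.\<close>
  have approx0: "\<exists>e. norm (S e) \<le> 2 * real n \<and> norm (y - e) < \<epsilon>"
    if y: "norm y < r" and "\<epsilon> > 0" for y \<epsilon>
  proof -
    have "y0 \<in> closure {y. norm (S y) \<le> real n}" "y0 + y \<in> closure {y. norm (S y) \<le> real n}"
      using r y by (auto simp: dist_norm subset_iff)
    then obtain a b where a: "norm (S a) \<le> n" "dist a y0 < \<epsilon>/2"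
      and b: "norm (S b) \<le> n" "dist b (y0 + y) < \<epsilon>/2"
      using \<open>\<epsilon> > 0\<close> unfolding closure_approachable by (metis half_gt_zero mem_Collect_eq)
    have "norm (S (b - a)) \<le> 2 * real n"
      unfolding Sdiff using a(1) b(1) norm_triangle_ineq4[of "S b" "S a"] by simp
    moreover have "norm (y - (b - a)) < \<epsilon>"
    proof -
      have "norm (y - (b - a)) = norm ((y0 + y - b) - (y0 - a))"
        by (simp add: algebra_simps)
      also have "\<dots> \<le> norm (y0 + y - b) + norm (y0 - a)" by (rule norm_triangle_ineq4)
      also have "\<dots> < \<epsilon>" using a(2) b(2) by (simp add: dist_norm norm_minus_commute)
      finally show ?thesis .
    qed
    ultimately show ?thesis by blast
  qed
  \<comment> \<open>Rescaling \<open>y\<close> to norm \<open>r / 2\<close> and approximating within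
    \<open>r / 4\<close> leaves an error of half the norm of \<open>y\<close>; undoing the scaling
    turns \<open>2 * n\<close> into \<open>K * norm y\<close>.\<close>
  define K where "K = 4 * real n / r"
  have "\<exists>z. norm (S z) \<le> K * norm y \<and> norm (y - z) \<le> norm y / 2" for y
  proof (cases "y = 0")
    case True
    then show ?thesis using Sscale[of 0 0] by (intro exI[of _ 0]) simp
  next
    case False
    define c where "c = 2 * norm y / r"
    have c: "c > 0" using False r by (simp add: c_def)
    have "norm (inverse c *\<^sub>R y) < r" using False r by (simp add: c_def)
    then obtain e where e: "norm (S e) \<le> 2 * real n" "norm (inverse c *\<^sub>R y - e) < r / 4"
      using approx0[of "inverse c *\<^sub>R y" "r / 4"] r by auto
    have "norm (S (c *\<^sub>R e)) \<le> c * (2 * real n)"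
      using e(1) c by (simp add: Sscale)
    moreover have "norm (y - c *\<^sub>R e) \<le> c * (r / 4)"
    proof -
      have "y - c *\<^sub>R e = c *\<^sub>R (inverse c *\<^sub>R y - e)"
        using c by (simp add: scaleR_right_diff_distrib)
      then show ?thesis using e(2) c by simp
    qed
    ultimately show ?thesis using r by (intro exI[of _ "c *\<^sub>R e"]) (simp add: c_def K_def mult_ac)
  qed
  then obtain f where f: "\<And>y. norm (S (f y)) \<le> K * norm y" "\<And>y. norm (y - f y) \<le> norm y / 2"
    by metis
  have K: "K \<ge> 0" using r by (simp add: K_def)
  have "norm (S y) \<le> norm y * (2 * K)" for y
  proof -
    \<comment> \<open>\<open>R k\<close> is the error left after \<open>k\<close> corrections; the
      corrections \<open>f (R k)\<close> are its successive decrements, so they telescope to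
      \<open>y\<close>.\<close>
    define R where "R k = ((\<lambda>z. z - f z) ^^ k) y" for k
    have R: "norm (R k) \<le> norm y * (1/2) ^ k" for k
    proof (induction k)
      case (Suc k)
      then show ?case using f(2)[of "R k"] by (simp add: R_def)
    qed (simp add: R_def)
    have sm: "norm (S (f (R k))) \<le> K * norm y * (1/2) ^ k" for k
      using f(1)[of "R k"] mult_left_mono[OF R[of k] K] by (simp add: mult.assoc)
    have gs: "(\<lambda>k. K * norm y * (1/2) ^ k) sums (K * norm y * 2)"
      using sums_mult[OF geometric_sums[of "1/2::real"], of "K * norm y"] by simp
    have smb: "summable (\<lambda>k. S (f (R k)))"
      by (rule summable_comparison_test'[OF sums_summable[OF gs] sm])
    have "R \<longlonglongrightarrow> 0"
    proof (rule Lim_null_comparison)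
      show "\<forall>\<^sub>F k in sequentially. norm (R k) \<le> norm y * (1/2) ^ k" using R by simp
      show "(\<lambda>k. norm y * (1/2) ^ k) \<longlonglongrightarrow> 0"
        by (intro tendsto_mult_right_zero LIMSEQ_power_zero) simp
    qed
    then have "(\<lambda>k. R k - R (Suc k)) sums (R 0 - 0)"
      by (rule telescope_sums')
    then have "(\<lambda>k. f (R k)) sums y" by (simp add: R_def)
    \<comment> \<open>Continuity of \<open>S\<close> is still unknown, so the limit is taken through
      \<open>T\<close>, and \<open>S y\<close> is then identified with the sum by applying the
      inverse.\<close>
    moreover have "(\<lambda>k. T (S (f (R k)))) sums T (\<Sum>k. S (f (R k)))"
      by (intro T.sums summable_sums smb)
    ultimately have "T (\<Sum>k. S (f (R k))) = y"
      by (simp add: TS sums_unique2)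
    then have "S y = (\<Sum>k. S (f (R k)))" using ST by metis
    also have "norm \<dots> \<le> (\<Sum>k. K * norm y * (1/2) ^ k)"
      by (rule norm_suminf_le[OF sm sums_summable[OF gs]])
    also have "\<dots> = K * norm y * 2" by (rule sums_unique[OF gs, symmetric])
    finally show ?thesis by (simp add: mult_ac)
  qed
  then show ?thesis
    unfolding S_def[symmetric] by (intro bounded_linear_intro[of S]) (auto simp: Sadd Sscale)
qed

section \<open>Orthogonal projections\<close>

lemma scaleC_zero_left [simp]: "0 *\<^sub>C (x::'a::complex_inner) = 0"
  using scaleR_scaleC[of 0 x] by simp

lemma scaleC_zero_right [simp]: "c *\<^sub>C (0::'a::complex_inner) = 0"
  using scaleC_scaleC[of c 0 "0::'a"] by simp

lemma scaleC_minus_one [simp]: "(- 1) *\<^sub>C (x::'a::complex_inner) = - x"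
  using scaleR_scaleC[of "- 1" x] by simp

lemma cinner_zero_left [simp]: "cinner 0 (y::'a::complex_inner) = 0"
  using cinner_scaleC_left[of 0 y y] by simp

lemma cinner_scaleC_right: "cinner x (a *\<^sub>C (y::'a::complex_inner)) = cnj a * cinner x y"
  by (metis cinner_commute cinner_scaleC_left complex_cnj_mult)

lemma cinner_self_eq_0: "cinner x x = 0 \<Longrightarrow> (x::'a::complex_inner) = 0"
  using inner_eq_Re_cinner[of x x] by simp

definition csubspace :: "'a::complex_inner set \<Rightarrow> bool" where
  "csubspace V \<longleftrightarrow>
     0 \<in> V \<and> (\<forall>x\<in>V. \<forall>y\<in>V. x + y \<in> V) \<and> (\<forall>c. \<forall>x\<in>V. c *\<^sub>C x \<in> V)"

lemma csubspaceD:
  assumes "csubspace V"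
  shows "0 \<in> V" "x \<in> V \<Longrightarrow> y \<in> V \<Longrightarrow> x + y \<in> V" "x \<in> V \<Longrightarrow> c *\<^sub>C x \<in> V"
    "x \<in> V \<Longrightarrow> y \<in> V \<Longrightarrow> x - y \<in> V"
proof -
  show "x - y \<in> V" if "x \<in> V" "y \<in> V"
  proof -
    have "x + (- 1) *\<^sub>C y \<in> V" using assms that unfolding csubspace_def by blast
    then show ?thesis by simp
  qed
qed (use assms in \<open>auto simp: csubspace_def\<close>)

lemma csubspace_imp_subspace: "csubspace V \<Longrightarrow> subspace V"
  by (auto simp: csubspace_def subspace_def scaleR_scaleC)

lemma csubspace_ortho: "csubspace (ortho S)"
  by (auto simp: csubspace_def ortho_def cinner_add_left cinner_scaleC_left)

lemma orthoD: "x \<in> ortho S \<Longrightarrow> y \<in> S \<Longrightarrow> cinner x y = 0"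
  by (simp add: ortho_def)

lemma cinner_eq_0_commute: "cinner x y = 0 \<longleftrightarrow> cinner y (x::'a::complex_inner) = 0"
  by (subst cinner_commute) simp

lemma subset_ortho_ortho: "S \<subseteq> ortho (ortho S)"
  unfolding ortho_def using cinner_eq_0_commute by blast

lemma in_ortho_self: "x \<in> V \<Longrightarrow> x \<in> ortho V \<Longrightarrow> x = 0"
  using cinner_self_eq_0 orthoD by blast

text \<open>For a complex subspace, real orthogonality already implies complex orthogonality, because
  the imaginary part of the form is its real part against \<open>\<i>\<close> times the vector.\<close>

lemma in_ortho_iff_inner:
  assumes "csubspace V"
  shows "x \<in> ortho V \<longleftrightarrow> (\<forall>y\<in>V. inner x y = 0)"
proof
  assume inner0: "\<forall>y\<in>V. inner x y = 0"
  have "cinner x y = 0" if "y \<in> V" for y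
  proof -
    have "Re (cinner x y) = 0" using inner0 that by (simp add: inner_eq_Re_cinner)
    moreover have "Re (cinner x (\<i> *\<^sub>C y)) = 0"
      using inner0 csubspaceD(3)[OF assms that] by (metis inner_eq_Re_cinner)
    ultimately show ?thesis by (simp add: cinner_scaleC_right complex_eq_iff)
  qed
  then show "x \<in> ortho V" by (simp add: ortho_def)
qed (simp add: ortho_def inner_eq_Re_cinner)

text \<open>Complex orthogonality to \<open>y\<close> amounts to real orthogonality to
  \<open>y\<close> and to its multiple by the imaginary unit, both closed conditions.\<close>

lemma closed_ortho: "closed (ortho (V::'a::complex_inner set))"
proof -
  have "x \<in> ortho V \<longleftrightarrow> (\<forall>y\<in>V. inner x y = 0 \<and> inner x (\<i> *\<^sub>C y) = 0)" for x
    unfolding ortho_def inner_eq_Re_cinner cinner_scaleC_right by (simp add: complex_eq_iff)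
  then have "ortho V = (\<Inter>y\<in>V. {x. inner x y = 0} \<inter> {x. inner x (\<i> *\<^sub>C y) = 0})"
    by blast
  moreover have "closed {x::'a. inner x y = 0}" for y
    by (intro closed_Collect_eq continuous_intros)
  ultimately show ?thesis by (simp add: closed_INT closed_Int)
qed

section \<open>Nearest points in closed subspaces\<close>

lemma parallelogram:
  fixes x y :: "'a::real_inner"
  shows "(norm (x + y))\<^sup>2 + (norm (x - y))\<^sup>2 = 2 * (norm x)\<^sup>2 + 2 * (norm y)\<^sup>2"
  by (simp add: power2_norm_eq_inner inner_simps inner_commute)

text \<open>The parallelogram law makes a minimising sequence Cauchy; completeness supplies its
  limit and closedness keeps it in \<open>V\<close>.\<close>

lemma subspace_nearest_point:
  fixes V :: "'a::{real_inner,complete_space} set"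
  assumes V: "subspace V" "closed V"
  obtains p where "p \<in> V" "\<And>v. v \<in> V \<Longrightarrow> norm (x - p) \<le> norm (x - v)"
proof -
  define d where "d = infdist x V"
  have ne: "V \<noteq> {}" using subspace_0[OF V(1)] by blast
  have d: "0 \<le> d" "\<And>v. v \<in> V \<Longrightarrow> d \<le> norm (x - v)"
    unfolding d_def by (auto simp: infdist_nonneg infdist_le dist_norm[symmetric])
  have "\<exists>v\<in>V. norm (x - v) < d + 1 / Suc n" for n
    using cInf_lessD[of "dist x ` V" "d + 1 / Suc n"] ne
    by (simp add: d_def infdist_notempty dist_norm)
  then obtain v where v: "\<And>n. v n \<in> V" "\<And>n. norm (x - v n) < d + 1 / Suc n" by metis
  have near: "(norm (v m - v n))\<^sup>2 \<le> (8 * d + 4) / Suc N" if "N \<le> m" "N \<le> n" for m n N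
  proof -
    let ?e = "1 / real (Suc N)"
    have sq: "(norm (x - v k))\<^sup>2 \<le> d\<^sup>2 + (2 * d + 1) * ?e" if "N \<le> k" for k
    proof -
      have "1 / real (Suc k) \<le> ?e" using that by (intro divide_left_mono) auto
      then have "norm (x - v k) \<le> d + ?e" using v(2)[of k] by linarith
      then have "(norm (x - v k))\<^sup>2 \<le> (d + ?e)\<^sup>2" by (intro power_mono) auto
      also have "\<dots> = d\<^sup>2 + 2 * d * ?e + ?e * ?e" by (simp add: power2_eq_square algebra_simps)
      also have "\<dots> \<le> d\<^sup>2 + 2 * d * ?e + 1 * ?e"
        by (intro add_left_mono mult_right_mono) auto
      finally show ?thesis by (simp add: algebra_simps)
    qed
    \<comment> \<open>The midpoint is at distance at least \<open>d\<close> from \<open>x\<close>,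
      so \<open>4 * d\<^sup>2\<close> can be subtracted in the parallelogram law, leaving only the
      small excesses.\<close>
    have "(1/2) *\<^sub>R (v m + v n) \<in> V" using V(1) v(1) by (simp add: subspace_add subspace_scale)
    then have "d \<le> norm (x - (1/2) *\<^sub>R (v m + v n))" by (rule d(2))
    moreover have "(x - v m) + (x - v n) = 2 *\<^sub>R (x - (1/2) *\<^sub>R (v m + v n))"
      by (simp add: algebra_simps scaleR_2)
    ultimately have "2 * d \<le> norm ((x - v m) + (x - v n))" by simp
    then have "(2 * d)\<^sup>2 \<le> (norm ((x - v m) + (x - v n)))\<^sup>2" using d(1) by (intro power_mono) auto
    moreover have "norm ((x - v m) - (x - v n)) = norm (v m - v n)"
      by (simp add: norm_minus_commute)
    ultimately have "(norm (v m - v n))\<^sup>2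
        \<le> 2 * (norm (x - v m))\<^sup>2 + 2 * (norm (x - v n))\<^sup>2 - 4 * d\<^sup>2"
      using parallelogram[of "x - v m" "x - v n"] by (simp add: power_mult_distrib)
    also have "\<dots> \<le> 4 * ((2 * d + 1) * ?e)" using sq[OF that(1)] sq[OF that(2)] by linarith
    finally show ?thesis by (simp add: algebra_simps add_divide_distrib)
  qed
  have "Cauchy v"
  proof (rule metric_CauchyI)
    fix e :: real assume "e > 0"
    have "(\<lambda>N. (8 * d + 4) / real (Suc N)) \<longlonglongrightarrow> 0"
      by (rule LIMSEQ_Suc[OF lim_const_over_n])
    then have "\<forall>\<^sub>F N in sequentially. (8 * d + 4) / real (Suc N) < e\<^sup>2"
      using \<open>e > 0\<close> by (intro order_tendstoD) auto
    then obtain N where N: "(8 * d + 4) / real (Suc N) < e\<^sup>2"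
      using eventually_happens'[OF sequentially_bot] by blast
    have "dist (v m) (v n) < e" if "m \<ge> N" "n \<ge> N" for m n
      using near[OF that] N \<open>e > 0\<close> by (intro power2_less_imp_less[of _ e]) (auto simp: dist_norm)
    then show "\<exists>M. \<forall>m\<ge>M. \<forall>n\<ge>M. dist (v m) (v n) < e" by blast
  qed
  then obtain p where p: "v \<longlonglongrightarrow> p"
    unfolding Cauchy_convergent_iff convergent_def by blast
  have "p \<in> V" using closed_sequentially[OF V(2)] v(1) p by blast
  moreover have "norm (x - p) \<le> d"
  proof (rule LIMSEQ_le)
    show "(\<lambda>n. norm (x - v n)) \<longlonglongrightarrow> norm (x - p)" by (intro tendsto_intros p)
    show "(\<lambda>n. d + 1 / real (Suc n)) \<longlonglongrightarrow> d"
      using tendsto_add[OF tendsto_const LIMSEQ_Suc[OF lim_const_over_n[of 1]], of d] by simp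
    show "\<exists>N. \<forall>n\<ge>N. norm (x - v n) \<le> d + 1 / real (Suc n)" using v(2) less_imp_le by blast
  qed
  ultimately show thesis using that d(2) order_trans by blast
qed

lemma nearest_point_orthogonal:
  fixes V :: "'a::real_inner set"
  assumes V: "subspace V" and p: "p \<in> V" "\<And>v. v \<in> V \<Longrightarrow> norm (x - p) \<le> norm (x - v)"
    and "v \<in> V"
  shows "inner (x - p) v = 0"
proof (cases "v = 0")
  case False
  \<comment> \<open>This \<open>t\<close> minimises the quadratic
    \<open>(norm (x - p - t *\<^sub>R v))\<^sup>2\<close>; minimality of \<open>p\<close> leaves no
    room for a decrease.\<close>
  define t where "t = inner (x - p) v / inner v v"
  have vv: "inner v v > 0" using False by simp
  have "p + t *\<^sub>R v \<in> V" using V p(1) \<open>v \<in> V\<close> by (simp add: subspace_add subspace_scale)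
  then have "(norm (x - p))\<^sup>2 \<le> (norm (x - p - t *\<^sub>R v))\<^sup>2"
    using p(2) by (intro power_mono) (auto simp: diff_diff_add)
  also have "\<dots> = (norm (x - p))\<^sup>2 - 2 * (t * inner (x - p) v) + t * (t * inner v v)"
  proof -
    have "(norm (a - t *\<^sub>R v))\<^sup>2 = (norm a)\<^sup>2 - 2 * (t * inner a v) + t * (t * inner v v)" for a
      unfolding power2_norm_eq_inner inner_diff_left inner_diff_right
      by (simp add: inner_commute[of v a])
    then show ?thesis .
  qed
  also have "t * inner v v = inner (x - p) v" using vv by (simp add: t_def)
  finally have "t * inner (x - p) v \<le> 0" by simp
  then have "(inner (x - p) v)\<^sup>2 \<le> 0"
    using vv by (simp add: t_def power2_eq_square divide_le_0_iff)
  then show ?thesis by simp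
qed simp

text \<open>Two candidates differ by a vector lying in both \<open>V\<close> and
  \<open>ortho V\<close>, so the definite description in \<open>Proj\<close> is unique.\<close>

lemma Proj_eqI:
  assumes V: "csubspace V" and p: "p \<in> V" "x - p \<in> ortho V"
  shows "Proj V x = p"
  unfolding Proj_def
proof (rule the_equality)
  fix q assume q: "q \<in> V \<and> x - q \<in> ortho V"
  then have "q - p \<in> V" using csubspaceD(4)[OF V] p(1) by blast
  moreover have "(x - p) - (x - q) \<in> ortho V"
    using csubspaceD(4)[OF csubspace_ortho] p(2) q by blast
  ultimately have "q - p = 0" by (intro in_ortho_self[of "q - p" V]) auto
  then show "q = p" by simp
qed (use p in blast)

lemma Proj_works:
  fixes V :: "'a::complex_hilbert set"
  assumes V: "csubspace V" "closed V"
  shows "Proj V x \<in> V" "x - Proj V x \<in> ortho V"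
proof -
  have sub: "subspace V" by (rule csubspace_imp_subspace[OF V(1)])
  obtain p where p: "p \<in> V" "\<And>v. v \<in> V \<Longrightarrow> norm (x - p) \<le> norm (x - v)"
    using subspace_nearest_point[OF sub V(2)] by blast
  have "x - p \<in> ortho V"
    using nearest_point_orthogonal[OF sub p] by (simp add: in_ortho_iff_inner[OF V(1)])
  then show "Proj V x \<in> V" "x - Proj V x \<in> ortho V"
    using Proj_eqI[OF V(1) p(1)] p(1) by auto
qed

lemma Proj_add:
  fixes V :: "'a::complex_hilbert set"
  assumes V: "csubspace V" "closed V"
  shows "Proj V (x + y) = Proj V x + Proj V y"
proof (rule Proj_eqI[OF V(1)])
  show "Proj V x + Proj V y \<in> V" using Proj_works[OF V] csubspaceD(2)[OF V(1)] by blast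
  have "(x - Proj V x) + (y - Proj V y) \<in> ortho V"
    using Proj_works[OF V] csubspaceD(2)[OF csubspace_ortho] by blast
  then show "x + y - (Proj V x + Proj V y) \<in> ortho V" by (simp add: algebra_simps)
qed

lemma Proj_scaleC:
  fixes V :: "'a::complex_hilbert set"
  assumes V: "csubspace V" "closed V"
  shows "Proj V (c *\<^sub>C x) = c *\<^sub>C Proj V x"
proof (rule Proj_eqI[OF V(1)])
  show "c *\<^sub>C Proj V x \<in> V" using Proj_works[OF V] csubspaceD(3)[OF V(1)] by blast
  have "c *\<^sub>C (x - Proj V x) \<in> ortho V"
    using Proj_works[OF V] csubspaceD(3)[OF csubspace_ortho] by blast
  moreover have "c *\<^sub>C x = c *\<^sub>C (x - Proj V x) + c *\<^sub>C Proj V x"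
    using scaleC_add_right[of c "x - Proj V x" "Proj V x"] by simp
  ultimately show "c *\<^sub>C x - c *\<^sub>C Proj V x \<in> ortho V" by simp
qed

lemma Proj_ident:
  assumes "csubspace V" "x \<in> V"
  shows "Proj V x = x"
  using assms csubspaceD(1)[OF csubspace_ortho] by (intro Proj_eqI) auto

lemma norm_Proj_le:
  fixes V :: "'a::complex_hilbert set"
  assumes V: "csubspace V" "closed V"
  shows "norm (Proj V x) \<le> norm x"
proof -
  have "inner (x - Proj V x) (Proj V x) = 0"
    using Proj_works[OF V] in_ortho_iff_inner[OF V(1)] by blast
  then have "(norm x)\<^sup>2 = (norm (Proj V x))\<^sup>2 + (norm (x - Proj V x))\<^sup>2"
    by (simp add: power2_norm_eq_inner inner_simps inner_commute)
  then have "(norm (Proj V x))\<^sup>2 \<le> (norm x)\<^sup>2" by simp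
  then show ?thesis by (rule power2_le_imp_le) simp
qed

text \<open>The kernel of the projection is \<open>ortho V\<close>. With \<open>V\<close> the
  complement of the image of \<open>null_space_of B\<close> under \<open>D\<close>, this trades
  equal projections for a correction term.\<close>

lemma Proj_eq_iff:
  fixes V :: "'a::complex_hilbert set"
  assumes V: "csubspace V" "closed V"
  shows "Proj V x = Proj V y \<longleftrightarrow> x - y \<in> ortho V"
proof
  assume eq: "Proj V x = Proj V y"
  have "(x - Proj V x) - (y - Proj V y) \<in> ortho V"
    using Proj_works[OF V] csubspaceD(4)[OF csubspace_ortho] by blast
  then show "x - y \<in> ortho V" by (simp add: eq)
next
  assume "x - y \<in> ortho V"
  then have "(x - y) + (y - Proj V y) \<in> ortho V"
    using Proj_works[OF V] csubspaceD(2)[OF csubspace_ortho] by blast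
  then show "Proj V x = Proj V y"
    using Proj_works(1)[OF V] by (intro Proj_eqI[OF V(1)]) auto
qed

text \<open>For \<open>x\<close> in the double complement, the remainder \<open>x - Proj V x\<close>
  lies in \<open>ortho V\<close> and in its complement, hence vanishes.\<close>

lemma ortho_ortho_closed:
  fixes V :: "'a::complex_hilbert set"
  assumes V: "csubspace V" "closed V"
  shows "ortho (ortho V) = V"
proof
  show "ortho (ortho V) \<subseteq> V"
  proof
    fix x assume x: "x \<in> ortho (ortho V)"
    have "Proj V x \<in> ortho (ortho V)" using Proj_works(1)[OF V] subset_ortho_ortho by blast
    then have "x - Proj V x \<in> ortho (ortho V)" using x csubspaceD(4)[OF csubspace_ortho] by blast
    then have "x - Proj V x = 0" using Proj_works(2)[OF V] in_ortho_self by blast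
    then show "x \<in> V" using Proj_works(1)[OF V, of x] by simp
  qed
qed (rule subset_ortho_ortho)

section \<open>Bounded operators\<close>

lemma bounded_op_UNIV_simps:
  assumes "bounded_op UNIV UNIV T"
  shows "T (x + y) = T x + T y" "T (c *\<^sub>C x) = c *\<^sub>C T x" "T 0 = 0" "T (x - y) = T x - T y"
    "T (- x) = - T x"
proof -
  show add: "T (x + y) = T x + T y" for x y using assms by (simp add: bounded_op_def)
  show sc: "T (c *\<^sub>C x) = c *\<^sub>C T x" for x c using assms by (simp add: bounded_op_def)
  show "T 0 = 0" using sc[of 0 0] by simp
  show neg: "T (- x) = - T x" for x using sc[of "- 1" x] by simp
  show "T (x - y) = T x - T y" using add[of x "- y"] by (simp add: neg)
qed

lemma bounded_op_imp_bounded_linear: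
  assumes "bounded_op UNIV UNIV T"
  shows "bounded_linear T"
proof -
  obtain K where "\<And>x. norm (T x) \<le> K * norm x" using assms by (auto simp: bounded_op_def)
  then show ?thesis
    by (intro bounded_linear_intro[of T K])
      (simp_all add: bounded_op_UNIV_simps[OF assms] scaleR_scaleC mult.commute)
qed

lemma bounded_op_UNIV_I:
  assumes "bounded_linear T" "\<And>c x. T (c *\<^sub>C x) = c *\<^sub>C T x"
  shows "bounded_op UNIV UNIV T"
  unfolding bounded_op_def
  using assms bounded_linear.bounded[OF assms(1)]
  by (auto simp: linear_add[OF bounded_linear.linear] mult.commute)

text \<open>The bounded inverse theorem above gives real linearity and boundedness of the inverse;
  complex homogeneity is checked separately.\<close>

lemma isomorphism_UNIV_iff_bij:
  fixes T :: "'a::complex_hilbert \<Rightarrow> 'b::complex_hilbert"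
  assumes T: "bounded_op UNIV UNIV T"
  shows "isomorphism UNIV UNIV T \<longleftrightarrow> bij T"
proof
  assume bij: "bij T"
  have "inv T (c *\<^sub>C y) = c *\<^sub>C inv T y" for c y
  proof (rule inv_f_eq[OF bij_is_inj[OF bij]])
    show "T (c *\<^sub>C inv T y) = c *\<^sub>C y"
      by (simp add: bounded_op_UNIV_simps[OF T] surj_f_inv_f[OF bij_is_surj[OF bij]])
  qed
  then have "bounded_op UNIV UNIV (inv T)"
    by (rule bounded_op_UNIV_I[OF bounded_linear_inv[OF bounded_op_imp_bounded_linear[OF T] bij]])
  then show "isomorphism UNIV UNIV T" using T bij by (simp add: isomorphism_def)
qed (simp add: isomorphism_def)

lemma csubspace_null_space:
  assumes "bounded_op UNIV UNIV T"
  shows "csubspace (null_space_of T)"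
  by (simp add: csubspace_def null_space_of_def bounded_op_UNIV_simps[OF assms])

lemma closed_null_space:
  assumes "bounded_op UNIV UNIV T"
  shows "closed (null_space_of T)"
  unfolding null_space_of_def
  by (intro closed_Collect_eq continuous_intros
      linear_continuous_on[OF bounded_op_imp_bounded_linear[OF assms]])

lemma null_space_decomposition:
  fixes T :: "'a::complex_hilbert \<Rightarrow> 'b::complex_inner"
  assumes T: "bounded_op UNIV UNIV T"
  obtains u v where "x = u + v" "T u = 0" "v \<in> ortho (null_space_of T)" "T v = T x"
proof -
  note N = csubspace_null_space[OF T] closed_null_space[OF T]
  let ?u = "Proj (null_space_of T) x"
  have "T ?u = 0" using Proj_works(1)[OF N] by (simp add: null_space_of_def)
  then show thesis
    using that[of ?u "x - ?u"] Proj_works(2)[OF N, of x] by (simp add: bounded_op_UNIV_simps[OF T])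
qed

text \<open>With a left inverse \<open>S\<close>, the image is the fixed point set of the continuous
  map sending \<open>y\<close> to \<open>T (S y)\<close>.\<close>

lemma closed_image_left_invertible:
  fixes V :: "'a::complex_hilbert set" and T :: "'a \<Rightarrow> 'b::complex_hilbert"
  assumes V: "csubspace V" "closed V" and T: "bounded_op UNIV UNIV T"
    and left_inv: "left_invertible V UNIV (restrict T V)"
  shows "csubspace (T ` V)" "closed (T ` V)"
proof -
  obtain S where S: "bounded_op UNIV V S" "\<And>x. x \<in> V \<Longrightarrow> S (T x) = x"
    using left_inv by (auto simp: left_invertible_def)
  have S_UNIV: "bounded_op UNIV UNIV S" using S(1) by (auto simp: bounded_op_def)
  have SV: "S y \<in> V" for y using S(1) by (simp add: bounded_op_def)
  have "T ` V = {y. T (S y) = y}"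
  proof (intro equalityI subsetI)
    fix y assume "y \<in> {y. T (S y) = y}"
    then have "y = T (S y)" by simp
    then show "y \<in> T ` V" using SV by blast
  qed (use S(2) in auto)
  then show "closed (T ` V)"
    by (simp, intro closed_Collect_eq continuous_intros
        linear_continuous_on[OF bounded_linear_compose[OF bounded_op_imp_bounded_linear[OF T]
            bounded_op_imp_bounded_linear[OF S_UNIV]]])
  show "csubspace (T ` V)"
    unfolding csubspace_def
  proof (intro conjI ballI allI)
    show "0 \<in> T ` V" using bounded_op_UNIV_simps(3)[OF T] csubspaceD(1)[OF V(1)] by force
  next
    fix y z assume "y \<in> T ` V" "z \<in> T ` V"
    then show "y + z \<in> T ` V"
      using bounded_op_UNIV_simps(1)[OF T, symmetric] csubspaceD(2)[OF V(1)] by auto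
  next
    fix c y assume "y \<in> T ` V"
    then show "c *\<^sub>C y \<in> T ` V"
      using bounded_op_UNIV_simps(2)[OF T, symmetric] csubspaceD(3)[OF V(1)] by auto
  qed
qed

section \<open>The block operator\<close>

lemma bounded_op_block_op:
  fixes A :: "'x::complex_inner \<Rightarrow> 'u::complex_inner" and B :: "'y::complex_inner \<Rightarrow> 'u"
    and C :: "'x \<Rightarrow> 'v::complex_inner" and D :: "'y \<Rightarrow> 'v"
  assumes A: "bounded_op UNIV UNIV A" and B: "bounded_op UNIV UNIV B"
    and C: "bounded_op UNIV UNIV C" and D: "bounded_op UNIV UNIV D"
  shows "bounded_op UNIV UNIV (block_op A B C D)"
proof (rule bounded_op_UNIV_I)
  show "bounded_linear (block_op A B C D)"
    unfolding block_op_def split_beta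
    by (intro bounded_linear_Pair bounded_linear_add
        bounded_linear_compose[OF bounded_op_imp_bounded_linear[OF A]]
        bounded_linear_compose[OF bounded_op_imp_bounded_linear[OF B]]
        bounded_linear_compose[OF bounded_op_imp_bounded_linear[OF C]]
        bounded_linear_compose[OF bounded_op_imp_bounded_linear[OF D]]
        bounded_linear_fst bounded_linear_snd)
  show "block_op A B C D (c *\<^sub>C z) = c *\<^sub>C block_op A B C D z" for c z
    by (simp add: block_op_def split_beta scaleC_prod_def scaleC_add_right
        bounded_op_UNIV_simps(2)[OF A] bounded_op_UNIV_simps(2)[OF B]
        bounded_op_UNIV_simps(2)[OF C] bounded_op_UNIV_simps(2)[OF D])
qed

text \<open>A vector of \<open>R\<close> is orthogonal to all of \<open>ortho R\<close>, so 0 is its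
  projection there.\<close>

lemma in_null_space_Proj_ortho_range:
  assumes "T x \<in> R"
  shows "x \<in> null_space_of (Proj (ortho R) \<circ> T)"
proof -
  have "Proj (ortho R) (T x) = 0"
    using assms subset_ortho_ortho csubspaceD(1)[OF csubspace_ortho]
    by (intro Proj_eqI[OF csubspace_ortho]) auto
  then show ?thesis by (simp add: null_space_of_def)
qed

section \<open>The operator in (ii) on first components of the kernel of
  \<open>row_op A B\<close>\<close>

context
  fixes A :: "'x::complex_hilbert \<Rightarrow> 'x" and B :: "'y::complex_hilbert \<Rightarrow> 'x"
  assumes A: "bounded_op UNIV UNIV A" and B: "bounded_op UNIV UNIV B"
begin

text \<open>Removing the component in the kernel of \<open>A\<close> leaves a vector of
  \<open>X2 A B\<close>. Hence the restricted functions \<open>A2t\<close> and \<open>C2\<close>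
  take their intended values at such \<open>x\<close>.\<close>

lemma in_X1_plus_X2:
  assumes "A x \<in> range B"
  shows "x \<in> sum_sub (X1 A) (X2 A B)"
proof -
  obtain u v where uv: "x = u + v" "A u = 0" "v \<in> ortho (null_space_of A)" "A v = A x"
    using null_space_decomposition[OF A] by blast
  have "v \<in> null_space_of (Proj (ortho (range B)) \<circ> A)"
    using assms uv(4) by (intro in_null_space_Proj_ortho_range) simp
  then have "v \<in> X2 A B"
    \<comment> \<open>Membership in \<open>X2\<close> asks for the double complement of a kernel,
      which contains that kernel.\<close>
    using uv(3) subset_ortho_ortho by (auto simp: X2_def ominus_def)
  then show ?thesis using uv by (auto simp: sum_sub_def X1_def null_space_of_def)
qed

text \<open>Any preimage of \<open>z\<close> under \<open>B\<close>, stripped of its component in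
  the kernel of \<open>B\<close>, lies in \<open>Y2 A B\<close> because its image \<open>z\<close>
  is also in the range of \<open>A\<close>.\<close>

lemma B2_inv_works:
  assumes "z \<in> range A" "z \<in> range B"
  shows "B2_inv A B z \<in> Y2 A B" "B (B2_inv A B z) = z"
proof -
  obtain y where y: "z = B y" using assms by blast
  obtain u v where uv: "y = u + v" "B u = 0" "v \<in> ortho (null_space_of B)" "B v = B y"
    using null_space_decomposition[OF B] by blast
  have "v \<in> null_space_of (Proj (ortho (range A)) \<circ> B)"
    using assms uv(4) y by (intro in_null_space_Proj_ortho_range) simp
  then have v: "v \<in> Y2 A B"
    using uv(3) subset_ortho_ortho by (auto simp: Y2_def ominus_def)
  then have z: "z \<in> B2 A B ` Y2 A B"
    using uv(4) y by (intro image_eqI[of _ _ v]) (simp_all add: B2_def)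
  show Y2: "B2_inv A B z \<in> Y2 A B" using inv_into_into[OF z] by (simp add: B2_inv_def)
  show "B (B2_inv A B z) = z"
    using f_inv_into_f[OF z] Y2 by (simp add: B2_inv_def B2_def)
qed

text \<open>Two solutions \<open>y\<close> of \<open>A x + B y = 0\<close> differ by an element of the kernel of \<open>B\<close>, whose image
  under \<open>D\<close> is annihilated by the projection; so the operator in (ii) may be computed with any
  solution instead of the distinguished one.\<close>

lemma C2_minus_D2_eq_Proj:
  assumes C: "bounded_op UNIV UNIV C" and D: "bounded_op UNIV UNIV D"
    and eq: "A x + B y = 0"
  shows "C2 A B C D x - D2 A B D (B2_inv A B (A2t A B x)) = Proj (RD_perp B D) (C x + D y)"
proof -
  let ?W = "RD_perp B D"
  have W: "csubspace ?W" "closed ?W"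
    unfolding RD_perp_def by (rule csubspace_ortho closed_ortho)+
  have Ax: "A x = B (- y)"
    using eq by (simp add: bounded_op_UNIV_simps[OF B] eq_neg_iff_add_eq_0)
  then have x: "x \<in> sum_sub (X1 A) (X2 A B)" using in_X1_plus_X2 by simp
  \<comment> \<open>Mind the sign: \<open>B y' = A x\<close>, so it is \<open>- y'\<close> that
    solves the equation, and \<open>y + y'\<close> that lies in the kernel of
    \<open>B\<close>.\<close>
  define y' where "y' = B2_inv A B (A x)"
  have y': "y' \<in> Y2 A B" "B y' = A x"
    using B2_inv_works[OF rangeI range_eqI[where f = B, OF Ax]] by (simp_all add: y'_def)
  have "Proj ?W (C x) = Proj ?W (C x + D y) + Proj ?W (D y')"
  proof -
    have "B (- (y + y')) = 0"
      using eq y'(2) by (simp add: bounded_op_UNIV_simps[OF B] add.commute minus_add_distrib[symmetric]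
          del: minus_add_distrib)
    then have "D (- (y + y')) \<in> ortho ?W"
      unfolding RD_perp_def using subset_ortho_ortho by (force simp: null_space_of_def)
    then have "C x - ((C x + D y) + D y') \<in> ortho ?W"
      by (simp add: bounded_op_UNIV_simps[OF D] algebra_simps)
    then show ?thesis by (metis Proj_eq_iff[OF W] Proj_add[OF W])
  qed
  then show ?thesis using x y' by (simp add: C2_def D2_def A2t_def y'_def)
qed

end

text \<open>For \<open>n\<close> in the kernel of \<open>B\<close> the block operator sends
  \<open>(0, n)\<close> to \<open>(0, D n)\<close>, so its inverse recovers \<open>n\<close> from
  \<open>D n\<close>.\<close>

lemma left_invertible_of_block_isomorphism:
  fixes B :: "'y::complex_hilbert \<Rightarrow> 'u::complex_inner"
    and A :: "'x::complex_hilbert \<Rightarrow> 'u" and C :: "'x \<Rightarrow> 'v::complex_inner"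
  assumes A: "bounded_op UNIV UNIV A" and B: "bounded_op UNIV UNIV B"
    and C: "bounded_op UNIV UNIV C" and D: "bounded_op UNIV UNIV D"
    and iso: "isomorphism UNIV UNIV (block_op A B C D)"
  shows "left_invertible (null_space_of B) UNIV (restrict D (null_space_of B))"
proof -
  let ?N = "null_space_of B" and ?M = "block_op A B C D"
  note N = csubspace_null_space[OF B] closed_null_space[OF B]
  have Minv: "bounded_op UNIV UNIV (inv ?M)" and inj: "inj ?M"
    using iso by (auto simp: isomorphism_def bij_is_inj)
  \<comment> \<open>The projection forces values into the kernel of \<open>B\<close> for every
    \<open>v\<close>; at \<open>v = D n\<close> it changes nothing.\<close>
  define S where "S v = Proj ?N (snd (inv ?M (0, v)))" for v
  obtain K where K: "\<And>z. norm (inv ?M z) \<le> K * norm z" using Minv by (auto simp: bounded_op_def)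
  have "bounded_op UNIV ?N S"
    unfolding bounded_op_def
  proof (intro conjI ballI allI exI)
    show "S v \<in> ?N" for v unfolding S_def by (rule Proj_works[OF N])
    show "S (v + w) = S v + S w" for v w
      using bounded_op_UNIV_simps(1)[OF Minv, of "(0, v)" "(0, w)"]
      by (simp add: S_def Proj_add[OF N])
    show "S (c *\<^sub>C v) = c *\<^sub>C S v" for c v
      using bounded_op_UNIV_simps(2)[OF Minv, of c "(0, v)"]
      by (simp add: S_def scaleC_prod_def Proj_scaleC[OF N])
    show "norm (S v) \<le> K * norm v" for v
    proof -
      have "norm (S v) \<le> norm (snd (inv ?M (0, v)))" unfolding S_def by (rule norm_Proj_le[OF N])
      also have "\<dots> \<le> norm (inv ?M (0, v))"
        using norm_snd_le[of "snd (inv ?M (0, v))" "fst (inv ?M (0, v))"] by simp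
      also have "\<dots> \<le> K * norm v" using K[of "(0, v)"] by simp
      finally show ?thesis .
    qed
  qed
  moreover have "S (D n) = n" if "n \<in> ?N" for n
  proof -
    have "?M (0, n) = (0, D n)"
      using that by (simp add: block_op_def null_space_of_def bounded_op_UNIV_simps(3)[OF A]
          bounded_op_UNIV_simps(3)[OF C])
    then have "inv ?M (0, D n) = (0, n)" using inj by (metis inv_f_f)
    then show ?thesis using that by (simp add: S_def Proj_ident[OF N(1)])
  qed
  moreover have "bounded_op ?N UNIV (restrict D ?N)"
    using D N(1) by (auto simp: bounded_op_def csubspace_def)
  ultimately show ?thesis unfolding left_invertible_def by (metis restrict_apply)
qed

text \<open>With \<open>D\<close> bounded below on the kernel of \<open>B\<close>, the image of that kernel is closed, hence equal
  to \<open>ortho (RD_perp B D)\<close>: equality of projections onto \<open>RD_perp B D\<close> is equality up to a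
  correction \<open>D n\<close> with \<open>B n = 0\<close>, which is invisible in the first row.\<close>

lemma bij_block_op_iff:
  fixes A :: "'x::complex_hilbert \<Rightarrow> 'u::complex_inner" and B :: "'y::complex_hilbert \<Rightarrow> 'u"
    and C :: "'x \<Rightarrow> 'v::complex_hilbert" and D :: "'y \<Rightarrow> 'v"
  assumes A: "bounded_op UNIV UNIV A" and B: "bounded_op UNIV UNIV B"
    and C: "bounded_op UNIV UNIV C" and D: "bounded_op UNIV UNIV D"
    and surj: "surj (row_op A B)"
    and left_inv: "left_invertible (null_space_of B) UNIV (restrict D (null_space_of B))"
    and F: "\<And>x y. A x + B y = 0 \<Longrightarrow> F x = Proj (ortho (D ` null_space_of B)) (C x + D y)"
  shows "bij (block_op A B C D) \<longleftrightarrow>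
    bij_betw F (fst ` null_space_of (row_op A B)) (ortho (D ` null_space_of B))"
    (is "_ \<longleftrightarrow> bij_betw F ?P ?W")
proof -
  let ?N = "null_space_of B" and ?M = "block_op A B C D"
  note simps = bounded_op_UNIV_simps[OF A] bounded_op_UNIV_simps[OF B]
    bounded_op_UNIV_simps[OF C] bounded_op_UNIV_simps[OF D]
  note N = csubspace_null_space[OF B] closed_null_space[OF B]
  have W: "csubspace ?W" "closed ?W" by (rule csubspace_ortho closed_ortho)+
  have DN: "ortho ?W = D ` ?N"
    by (rule ortho_ortho_closed[OF closed_image_left_invertible[OF N D left_inv]])
  have inj_DN: "n = 0" if "B n = 0" "D n = 0" for n
  proof -
    obtain S where S: "\<And>x. x \<in> ?N \<Longrightarrow> S (D x) = x"
      using left_inv by (auto simp: left_invertible_def)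
    have "0 \<in> ?N" "n \<in> ?N" using that(1) by (simp_all add: null_space_of_def simps)
    then have "S (D n) = n" "S (D 0) = 0" by (simp_all add: S)
    then show ?thesis using that(2) by (simp add: simps)
  qed
  have P: "x \<in> ?P \<longleftrightarrow> (\<exists>y. A x + B y = 0)" for x
    unfolding image_def null_space_of_def row_op_def by auto
  have Proj_eq: "Proj ?W v = Proj ?W w \<longleftrightarrow> (\<exists>n. B n = 0 \<and> v - w = D n)" for v w
    unfolding Proj_eq_iff[OF W] DN by (auto simp: null_space_of_def)
  show ?thesis
  proof
    assume bij: "bij ?M"
    show "bij_betw F ?P ?W"
      unfolding bij_betw_def
    proof (intro conjI inj_onI equalityI subsetI)
      fix x x' assume "x \<in> ?P" "x' \<in> ?P" and eq: "F x = F x'"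
      then obtain y y' where y: "A x + B y = 0" "A x' + B y' = 0" using P by blast
      then obtain n where n: "B n = 0" "(C x + D y) - (C x' + D y') = D n"
        using eq Proj_eq by (auto simp: F)
      \<comment> \<open>Absorbing \<open>n\<close> into the second component repairs the second row
        and leaves the first untouched, as \<open>B n = 0\<close>.\<close>
      have "?M (x, y) = ?M (x', y' + n)"
        using y n by (simp add: block_op_def simps algebra_simps)
      then show "x = x'" using bij by (simp add: bij_is_inj inj_eq)
    next
      fix w assume "w \<in> F ` ?P"
      then obtain x y where "w = F x" "A x + B y = 0" using P by blast
      then show "w \<in> ?W" using F Proj_works(1)[OF W] by simp
    next
      fix w assume w: "w \<in> ?W"
      \<comment> \<open>The zero first row puts \<open>x\<close> into \<open>?P\<close>; the second
        row \<open>w\<close> is already in \<open>?W\<close>, so projecting fixes it.\<close>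
      obtain x y where "?M (x, y) = (0, w)" using bij by (metis bij_is_surj surj_def surj_pair)
      then have xy: "A x + B y = 0" "C x + D y = w" by (simp_all add: block_op_def)
      then have "F x = w" using F Proj_ident[OF W(1) w] by simp
      then show "w \<in> F ` ?P" using xy(1) P by blast
    qed
  next
    assume bij: "bij_betw F ?P ?W"
    show "bij ?M"
    proof (rule bijI)
      have "z = 0" if "?M z = 0" for z
      proof -
        obtain x y where z: "z = (x, y)" by force
        have xy: "A x + B y = 0" "C x + D y = 0" using that by (simp_all add: z block_op_def zero_prod_def)
        have "F x = F 0" using F[OF xy(1)] F[of 0 0] xy(2) by (simp add: simps)
        moreover have "x \<in> ?P" "0 \<in> ?P" using xy(1) P simps by (metis add_0)+
        ultimately have "x = 0" using bij by (meson bij_betw_def inj_onD)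
        then show ?thesis using xy inj_DN[of y] by (simp add: z simps zero_prod_def)
      qed
      then show "inj ?M"
        using linear_injective_0[OF bounded_linear.linear[OF bounded_op_imp_bounded_linear[OF
              bounded_op_block_op[OF A B C D]]]] by blast
      show "surj ?M"
        unfolding surj_def
      proof
        fix z :: "'u \<times> 'v"
        obtain u v where z: "z = (u, v)" by force
        \<comment> \<open>The preimage is built in three stages: \<open>(x0, y0)\<close> settles the
          first row, the kernel pair \<open>(x, y)\<close> settles the second row up to the image of
          \<open>?N\<close> under \<open>D\<close>, and \<open>n\<close> removes that rest.\<close>
        obtain x0 y0 where 0: "A x0 + B y0 = u"
          using surj unfolding surj_def row_op_def split_beta by metis
        define w where "w = v - (C x0 + D y0)"
        obtain x y where xy: "A x + B y = 0" "F x = Proj ?W w"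
          using bij Proj_works(1)[OF W, of w] P unfolding bij_betw_def by (metis imageE)
        then obtain n where n: "B n = 0" "w - (C x + D y) = D n"
          using Proj_eq F by metis
        have "?M (x0 + x, y0 + (y + n)) = z"
        proof -
          have "A (x0 + x) + B (y0 + (y + n)) = (A x0 + B y0) + (A x + B y) + B n"
            by (simp add: simps)
          moreover have "C (x0 + x) + D (y0 + (y + n)) = (C x0 + D y0) + (C x + D y) + D n"
            by (simp add: simps)
          ultimately show ?thesis
            using 0 xy(1) n by (simp add: z block_op_def w_def flip: n(2))
        qed
        then show "\<exists>a. z = ?M a" by blast
      qed
    qed
  qed
qed

theorem theorem2p10:
  fixes A :: "'x::complex_hilbert \<Rightarrow> 'x"
    and B :: "'y::complex_hilbert \<Rightarrow> 'x"
    and C :: "'x \<Rightarrow> 'y"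
    and D :: "'y \<Rightarrow> 'y"
  assumes "separable_space (euclidean :: 'x topology)"
    and "separable_space (euclidean :: 'y topology)"
    and "bounded_op UNIV UNIV A"
    and "bounded_op UNIV UNIV B"
    and "right_invertible UNIV UNIV (row_op A B)"
    and "bounded_op UNIV UNIV C"
    and "bounded_op UNIV UNIV D"
  shows "isomorphism UNIV UNIV (block_op A B C D) \<longleftrightarrow>
     left_invertible (null_space_of B) UNIV (restrict D (null_space_of B)) \<and>
     bij_betw (\<lambda>x. C2 A B C D x - D2 A B D (B2_inv A B (A2t A B x)))
       (fst ` null_space_of (row_op A B)) (RD_perp B D)"
proof -
  note A = assms(3) and B = assms(4) and C = assms(6) and D = assms(7)
  have "surj (row_op A B)"
    using assms(5) unfolding right_invertible_def surj_def by (metis UNIV_I)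
  \<comment> \<open>Left invertibility stays open as a premise: in one direction it follows from the
    isomorphism, in the other it is (i).\<close>
  note bij_iff = bij_block_op_iff[OF A B C D this _
      C2_minus_D2_eq_Proj[OF A B C D, unfolded RD_perp_def], folded RD_perp_def]
  show ?thesis
    using left_invertible_of_block_isomorphism[OF A B C D] bij_iff
      isomorphism_UNIV_iff_bij[OF bounded_op_block_op[OF A B C D]] by blast
qed

end
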